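(* There exist a polynomial map $F:\mathbb{R}^4\to\mathbb{R}^2$ and a point $t_0\in\mathbb{R}^2$ such that: (1) $t_0$ is an interior point of $\operatorname{Im} F\setminus F(\operatorname{Sing}(F))$; (2) there is a neighbourhood of $t_0$ in $\mathbb{R}^2$ over which all the fibres $F^{-1}(t)$ are connected and pairwise diffeomorphic; (3) $t_0\in B(F)$, i.e. $t_0$ is a bifurcation value of $F$.
   Context: For a polynomial map $F:\mathbb{R}^m\to\mathbb{R}^p$ with $m\ge p\ge 1$, $\operatorname{Sing}(F)$ denotes the set of points of $\mathbb{R}^m$ at which $F$ is not a submersion, and $\operatorname{Im} F$ is the image of $F$. $F$ is called (locally) $\mathcal{C}^\infty$ trivial at $t_0\in\mathbb{R}^p$ if there is a neighbourhood $D$ of $t_0$ such that the restriction $F_|:F^{-1}(D)\to D$ is a $\mathcal{C}^\infty$ trivial fibration, i.e. there is a $\mathcal{C}^\infty$ diffeomorphism $\Phi:F^{-1}(D)\to F^{-1}(t_0)\times D$ with $p_2\circ\Phi=F_|$, where $p_2$ is the projection to $D$. A point $t_0$ is a bifurcation value of $F$ if $F$ is not $\mathcal{C}^\infty$ trivial at $t_0$; the set of bifurcation values is denoted $B(F)$. *)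

theory Defs
  imports "HOL-Analysis.Analysis"
begin

text \<open>
  Intended for open sets \<open>S\<close> only. In finite dimension, being of class \<open>C\<^sup>k\<close> with \<open>k > 0\<close> means
  being differentiable with all directional derivatives of class \<open>C\<^sup>k\<^sup>-\<^sup>1\<close>.
\<close>
primrec Ck_on_open ::
    "nat \<Rightarrow> 'a::euclidean_space set \<Rightarrow> ('a \<Rightarrow> 'b::euclidean_space) \<Rightarrow> bool" where
  "Ck_on_open 0 S f \<longleftrightarrow> continuous_on S f"
| "Ck_on_open (Suc k) S f \<longleftrightarrow>
     (\<forall>x\<in>S. f differentiable (at x)) \<and>
     (\<forall>v. Ck_on_open k S (\<lambda>x. frechet_derivative f (at x) v))"

text \<open>
  Smoothness on an arbitrary subset of a Euclidean space: local existence of smooth extensions to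
  open sets of the ambient space. On embedded submanifolds (such as the fibres over regular values)
  this is smoothness with respect to the submanifold structure.
\<close>
definition smooth_on ::
    "'a::euclidean_space set \<Rightarrow> ('a \<Rightarrow> 'b::euclidean_space) \<Rightarrow> bool" where
  "smooth_on A f \<longleftrightarrow>
     (\<forall>x\<in>A. \<exists>U g. open U \<and> x \<in> U \<and> (\<forall>k. Ck_on_open k U g) \<and> (\<forall>y\<in>A \<inter> U. g y = f y))"

definition diffeomorphism ::
    "'a::euclidean_space set \<Rightarrow> 'b::euclidean_space set \<Rightarrow> ('a \<Rightarrow> 'b) \<Rightarrow> ('b \<Rightarrow> 'a) \<Rightarrow> bool" where
  "diffeomorphism A B f g \<longleftrightarrow>
     smooth_on A f \<and> f ` A = B \<and> (\<forall>x\<in>A. g (f x) = x) \<and>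
     smooth_on B g \<and> g ` B = A \<and> (\<forall>y\<in>B. f (g y) = y)"

definition diffeomorphic ::
    "'a::euclidean_space set \<Rightarrow> 'b::euclidean_space set \<Rightarrow> bool" where
  "diffeomorphic A B \<longleftrightarrow> (\<exists>f g. diffeomorphism A B f g)"

definition submersion_at ::
    "('a::euclidean_space \<Rightarrow> 'b::euclidean_space) \<Rightarrow> 'a \<Rightarrow> bool" where
  "submersion_at F x \<longleftrightarrow> (\<exists>F'. (F has_derivative F') (at x) \<and> surj F')"

definition Sing :: "('a::euclidean_space \<Rightarrow> 'b::euclidean_space) \<Rightarrow> 'a set" where
  "Sing F = {x. \<not> submersion_at F x}"

text \<open>
  Restricting a trivialisation to a smaller base keeps it a trivialisation, so it is no loss of
  generality to take the neighbourhood \<open>D\<close> of \<open>t0\<close> to be open.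
\<close>
definition smoothly_trivial_at ::
    "('a::euclidean_space \<Rightarrow> 'b::euclidean_space) \<Rightarrow> 'b \<Rightarrow> bool" where
  "smoothly_trivial_at F t0 \<longleftrightarrow>
     (\<exists>D \<Phi> \<Psi>. open D \<and> t0 \<in> D \<and>
        diffeomorphism (F -` D) ((F -` {t0}) \<times> D) \<Phi> \<Psi> \<and>
        (\<forall>x\<in>F -` D. snd (\<Phi> x) = F x))"

definition bifurcation_values ::
    "('a::euclidean_space \<Rightarrow> 'b::euclidean_space) \<Rightarrow> 'b set" where
  "bifurcation_values F = {t0. \<not> smoothly_trivial_at F t0}"

end

theory Submission
  imports Defs
begin

text \<open>
  The surface \<open>z * P s x y = t\<close> with \<open>t \<noteq> 0\<close> is a graph over the complement of the zero set of
  \<open>P s\<close>. We take a polynomial \<open>P\<close> such that \<open>P s\<close> vanishes at exactly one point of the plane for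
  every \<open>s\<close>, namely \<open>(1/s, 0)\<close> if \<open>s \<noteq> 0\<close> and the origin if \<open>s = 0\<close>. With
  \<open>F (x, y, z, s) = (s, z * P s x y)\<close> all fibres near \<open>(0, 1)\<close> are then once punctured planes, but
  the puncture escapes to infinity as \<open>s\<close> tends to \<open>0\<close>, where another one appears. If \<open>F\<close> were trivial
  at \<open>(0, 1)\<close>, then the graph over a cap that spans the unit circle of the plane \<open>s = 0\<close> in the region
  \<open>s \<ge> 0\<close> and avoids both kinds of punctures could be pushed into the fibre over \<open>(0, 1)\<close>. This would
  make the unit circle null-homotopic in the plane punctured at the origin.
\<close>

section \<open>Smoothness of rational maps\<close>

text \<open>The derivatives are taken in the ambient space; on an open set they depend only on the
  values in that set, so agreement passes to each further derivative.\<close>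

lemma Ck_on_open_cong:
  assumes "open S" "\<And>x. x \<in> S \<Longrightarrow> f x = g x" "Ck_on_open k S f"
  shows "Ck_on_open k S g"
  using assms(2,3)
proof (induction k arbitrary: f g)
  case 0
  then show ?case by (auto cong: continuous_on_cong_simp)
next
  case (Suc k)
  have d: "(g has_derivative frechet_derivative f (at x)) (at x)" if "x \<in> S" for x
    using _ \<open>open S\<close> that Suc.prems(1)
    by (rule has_derivative_transform_within_open)
      (use Suc.prems(2) that in \<open>simp_all flip: frechet_derivative_works\<close>)
  then have "frechet_derivative f (at x) = frechet_derivative g (at x)" if "x \<in> S" for x
    using frechet_derivative_at that by blast
  moreover have "g differentiable (at x)" if "x \<in> S" for x
    using d that differentiable_def by blast
  ultimately show ?case
    using Suc.IH[of "\<lambda>x. frechet_derivative f (at x) v" "\<lambda>x. frechet_derivative g (at x) v" for v]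
      Suc.prems by auto
qed

lemma real_polynomial_function_frechet_derivative:
  fixes f :: "'a::euclidean_space \<Rightarrow> real"
  assumes "real_polynomial_function f"
  shows "real_polynomial_function (\<lambda>x. frechet_derivative f (at x) v)"
  using assms
proof induction
  case (linear f)
  then have "frechet_derivative f (at x) = f" for x
    by (intro frechet_derivative_at[symmetric] bounded_linear_imp_has_derivative)
  then show ?case by auto
next
  case (const c)
  then show ?case by auto
next
  case (add f g)
  then have "((\<lambda>x. f x + g x) has_derivative
      (\<lambda>h. frechet_derivative f (at x) h + frechet_derivative g (at x) h)) (at x)" for x
    by (intro has_derivative_add)
      (auto simp: frechet_derivative_works[symmetric] differentiable_at_real_polynomial_function)
  then have "frechet_derivative (\<lambda>x. f x + g x) (at x) =
      (\<lambda>h. frechet_derivative f (at x) h + frechet_derivative g (at x) h)" for x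
    by (rule frechet_derivative_at[symmetric])
  with add show ?case by auto
next
  case (mult f g)
  then have "((\<lambda>x. f x * g x) has_derivative
      (\<lambda>h. f x * frechet_derivative g (at x) h + frechet_derivative f (at x) h * g x)) (at x)" for x
    by (intro has_derivative_mult)
      (auto simp: frechet_derivative_works[symmetric] differentiable_at_real_polynomial_function)
  then have "frechet_derivative (\<lambda>x. f x * g x) (at x) =
      (\<lambda>h. f x * frechet_derivative g (at x) h + frechet_derivative f (at x) h * g x)" for x
    by (rule frechet_derivative_at[symmetric])
  with mult show ?case by auto
qed

lemma polynomial_function_frechet_derivative:
  fixes f :: "'a::euclidean_space \<Rightarrow> 'b::euclidean_space"
  assumes "polynomial_function f"
  shows "polynomial_function (\<lambda>x. frechet_derivative f (at x) v)"
  unfolding polynomial_function_iff_Basis_inner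
proof
  fix b :: 'b assume "b \<in> Basis"
  have "((\<lambda>x. f x \<bullet> b) has_derivative (\<lambda>h. frechet_derivative f (at x) h \<bullet> b)) (at x)" for x
    using assms
    by (intro has_derivative_inner_left)
      (auto simp: frechet_derivative_works[symmetric] differentiable_at_polynomial_function)
  then have "frechet_derivative (\<lambda>x. f x \<bullet> b) (at x) = (\<lambda>h. frechet_derivative f (at x) h \<bullet> b)" for x
    by (rule frechet_derivative_at[symmetric])
  moreover have "real_polynomial_function (\<lambda>x. f x \<bullet> b)"
    using assms \<open>b \<in> Basis\<close> by (simp add: polynomial_function_iff_Basis_inner)
  ultimately show "real_polynomial_function (\<lambda>x. frechet_derivative f (at x) v \<bullet> b)"
    using real_polynomial_function_frechet_derivative[of "\<lambda>x. f x \<bullet> b" v] by simp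
qed

text \<open>By the quotient rule a directional derivative of \<open>p / q\<close> is again a
  polynomial map over a polynomial, with denominator \<open>q * q\<close>, which has no zeros in
  \<open>S\<close> either. The induction on \<open>k\<close> therefore has to vary \<open>p\<close>
  and \<open>q\<close>.\<close>

lemma Ck_on_open_rational:
  fixes p :: "'a::euclidean_space \<Rightarrow> 'b::euclidean_space"
  assumes "open S" "polynomial_function p" "real_polynomial_function q" "\<And>x. x \<in> S \<Longrightarrow> q x \<noteq> 0"
  shows "Ck_on_open k S (\<lambda>x. p x /\<^sub>R q x)"
  using assms(2-)
proof (induction k arbitrary: p q)
  case 0
  then show ?case
    by (auto intro!: continuous_intros simp: continuous_on_polymonial_function real_polynomial_function_eq)
next
  case (Suc k)
  let ?p' = "\<lambda>x. frechet_derivative p (at x)" and ?q' = "\<lambda>x. frechet_derivative q (at x)"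
  have d: "((\<lambda>x. p x /\<^sub>R q x) has_derivative
      (\<lambda>h. (q x *\<^sub>R ?p' x h - ?q' x h *\<^sub>R p x) /\<^sub>R (q x * q x))) (at x)" if "x \<in> S" for x
  proof -
    have "q x \<noteq> 0" using Suc.prems that by blast
    moreover have "(p has_derivative ?p' x) (at x)" "(q has_derivative ?q' x) (at x)"
      using Suc.prems by (auto simp: frechet_derivative_works[symmetric]
          differentiable_at_polynomial_function differentiable_at_real_polynomial_function)
    ultimately show ?thesis
      by (auto intro!: derivative_eq_intros simp: fun_eq_iff algebra_simps)
  qed
  show ?case
    unfolding Ck_on_open.simps
  proof (intro conjI ballI allI)
    show "(\<lambda>x. p x /\<^sub>R q x) differentiable at x" if "x \<in> S" for x
      using d[OF that] differentiable_def by blast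
    fix v
    have "Ck_on_open k S (\<lambda>x. (q x *\<^sub>R ?p' x v - ?q' x v *\<^sub>R p x) /\<^sub>R (q x * q x))"
    proof (rule Suc.IH)
      show "polynomial_function (\<lambda>x. q x *\<^sub>R ?p' x v - ?q' x v *\<^sub>R p x)"
        using Suc.prems
        by (auto intro!: polynomial_function_diff polynomial_function_mult
            polynomial_function_frechet_derivative simp: real_polynomial_function_eq)
    qed (use Suc.prems in auto)
    then show "Ck_on_open k S (\<lambda>x. frechet_derivative (\<lambda>x. p x /\<^sub>R q x) (at x) v)"
      by (rule Ck_on_open_cong[OF \<open>open S\<close>, rotated]) (rule fun_cong[OF frechet_derivative_at[OF d]])
  qed
qed

text \<open>The formula itself is the smooth extension, on the open set where \<open>q\<close> is
  nonzero. Hence \<open>A\<close> may be a fibre, which is not open.\<close>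

lemma smooth_on_rational:
  fixes p :: "'a::euclidean_space \<Rightarrow> 'b::euclidean_space"
  assumes "polynomial_function p" "real_polynomial_function q"
    and "\<And>x. x \<in> A \<Longrightarrow> q x \<noteq> 0" "\<And>x. x \<in> A \<Longrightarrow> f x = p x /\<^sub>R q x"
  shows "smooth_on A f"
proof -
  have "continuous_on UNIV q"
    using assms(2) by (simp add: continuous_on_polymonial_function real_polynomial_function_eq)
  then have "open {x. q x \<noteq> 0}"
    by (simp add: open_Collect_neq)
  then have "Ck_on_open k {x. q x \<noteq> 0} (\<lambda>x. p x /\<^sub>R q x)" for k
    using assms(1,2) by (rule Ck_on_open_rational) simp
  with \<open>open {x. q x \<noteq> 0}\<close> assms(3,4) show ?thesis
    unfolding smooth_on_def
    by (intro ballI exI[of _ "{x. q x \<noteq> 0}"] exI[of _ "\<lambda>x. p x /\<^sub>R q x"]) auto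
qed

text \<open>Turns a smooth trivialisation into continuous data, the form in which the topological
  obstruction uses it.\<close>

lemma smooth_on_imp_continuous_on:
  assumes "smooth_on A f"
  shows "continuous_on A f"
  unfolding continuous_on_eq_continuous_within
proof
  fix x assume "x \<in> A"
  then obtain U g where U: "open U" "x \<in> U" "\<And>k. Ck_on_open k U g" "\<And>y. y \<in> A \<inter> U \<Longrightarrow> g y = f y"
    using assms unfolding smooth_on_def by meson
  from U(3)[of 0] have "isCont g x"
    using U(1,2) by (simp add: continuous_on_eq_continuous_at)
  then have "continuous (at x within A) g"
    by (rule continuous_at_imp_continuous_at_within)
  moreover have "\<forall>\<^sub>F y in at x within A. g y = f y"
    unfolding eventually_at_topological using U by blast
  moreover have "g x = f x"
    using U \<open>x \<in> A\<close> by blast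
  ultimately show "continuous (at x within A) f"
    unfolding continuous_within by (metis Lim_transform_eventually)
qed

text \<open>Differentiating \<open>F (G s) = s\<close> exhibits \<open>G'\<close> as a right inverse
  of \<open>F'\<close>. This replaces a computation of the Jacobian.\<close>

lemma submersion_at_local_section:
  assumes "F differentiable (at (G t))" "G differentiable (at t)"
    and "open U" "t \<in> U" "\<And>s. s \<in> U \<Longrightarrow> F (G s) = s"
  shows "submersion_at F (G t)"
proof -
  obtain F' G' where F': "(F has_derivative F') (at (G t))" and G': "(G has_derivative G') (at t)"
    using assms unfolding differentiable_def by auto
  have "(F \<circ> G has_derivative F' \<circ> G') (at t)"
    using F' G' by (rule diff_chain_at[rotated])
  then have "((\<lambda>s. s) has_derivative F' \<circ> G') (at t)"
    by (rule has_derivative_transform_within_open) (use assms in auto)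
  then have "F' \<circ> G' = (\<lambda>h. h)"
    using has_derivative_ident has_derivative_unique by blast
  then have "surj F'"
    by (metis comp_apply surjI)
  with F' show ?thesis
    unfolding submersion_at_def by blast
qed

section \<open>Coordinates, the map \<open>F\<close> and its regular values\<close>

lemma vector_4:
  "(vector [a, b, c, d] :: 'a::zero ^ 4) $ 1 = a"
  "(vector [a, b, c, d] :: 'a::zero ^ 4) $ 2 = b"
  "(vector [a, b, c, d] :: 'a::zero ^ 4) $ 3 = c"
  "(vector [a, b, c, d] :: 'a::zero ^ 4) $ 4 = d"
  unfolding vector_def by simp_all

lemma polynomial_function_iff_vec_nth:
  fixes f :: "'a::euclidean_space \<Rightarrow> real ^ 'n"
  shows "polynomial_function f \<longleftrightarrow> (\<forall>i. real_polynomial_function (\<lambda>x. f x $ i))"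
  by (auto simp: polynomial_function_iff_Basis_inner Basis_vec_def inner_axis)

lemma real_polynomial_function_vec_nth:
  "real_polynomial_function (\<lambda>x :: real ^ 'n. x $ i)"
  by (intro real_polynomial_function.intros(1) bounded_linear_vec_nth)

text \<open>Both summands are nonnegative, so a zero kills both. The factor
  \<open>x\<^sup>2 + s\<^sup>2\<close> yields the origin only if \<open>s = 0\<close>, the factor
  \<open>(s * x - 1)\<^sup>2\<close> yields a zero only if \<open>s \<noteq> 0\<close>.\<close>

definition P :: "real \<Rightarrow> real \<Rightarrow> real \<Rightarrow> real" where
  "P s x y = y\<^sup>2 + (x\<^sup>2 + s\<^sup>2) * (s * x - 1)\<^sup>2"

definition F :: "real ^ 4 \<Rightarrow> real ^ 2" where
  "F v = vector [v $ 4, v $ 3 * P (v $ 4) (v $ 1) (v $ 2)]"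

text \<open>Since \<open>1 / 0 = 0\<close>, the zero of \<open>P s\<close> is \<open>(1 / s, 0)\<close> also for \<open>s = 0\<close>.\<close>

lemma P_eq_0_iff: "P s x y = 0 \<longleftrightarrow> x = 1 / s \<and> y = 0"
proof -
  have "P s x y = 0 \<longleftrightarrow> y\<^sup>2 = 0 \<and> (x\<^sup>2 + s\<^sup>2) * (s * x - 1)\<^sup>2 = 0"
    unfolding P_def by (rule add_nonneg_eq_0_iff) auto
  then have "P s x y = 0 \<longleftrightarrow> y = 0 \<and> (x = 0 \<and> s = 0 \<or> s * x = 1)"
    by (simp add: sum_power2_eq_zero_iff)
  then show ?thesis
    by (cases "s = 0") (auto simp: field_simps)
qed

lemma real_polynomial_function_P:
  assumes "real_polynomial_function f" "real_polynomial_function g" "real_polynomial_function h"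
  shows "real_polynomial_function (\<lambda>x. P (f x) (g x) (h x))"
  unfolding P_def using assms
  by (intro real_polynomial_function.intros(2-) real_polynomial_function_diff
      real_polynomial_function_power)

lemmas rpf_intros = real_polynomial_function_P real_polynomial_function_vec_nth
  real_polynomial_function.intros(2-) real_polynomial_function_diff

lemma continuous_on_P [continuous_intros]:
  assumes "continuous_on A f" "continuous_on A g" "continuous_on A h"
  shows "continuous_on A (\<lambda>x. P (f x) (g x) (h x))"
  unfolding P_def by (intro continuous_intros assms)

lemma polynomial_function_F: "polynomial_function F"
  unfolding polynomial_function_iff_vec_nth forall_2 F_def vector_2 by (intro conjI rpf_intros)

lemma continuous_on_vector_4:
  fixes a b c d :: "'a::topological_space \<Rightarrow> real"
  assumes "continuous_on A a" "continuous_on A b" "continuous_on A c" "continuous_on A d"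
  shows "continuous_on A (\<lambda>x. vector [a x, b x, c x, d x] :: real ^ 4)"
proof -
  have "continuous_on A (\<lambda>x. \<chi> i. (vector [a x, b x, c x, d x] :: real ^ 4) $ i)"
  proof (rule continuous_on_vec_lambda)
    have "\<forall>i::4. continuous_on A (\<lambda>x. (vector [a x, b x, c x, d x] :: real ^ 4) $ i)"
      unfolding forall_4 vector_4 using assms by blast
    then show "continuous_on A (\<lambda>x. (vector [a x, b x, c x, d x] :: real ^ 4) $ i)" for i
      by blast
  qed
  then show ?thesis by simp
qed

lemma mem_fibre_iff:
  "v \<in> F -` {t} \<longleftrightarrow> v $ 4 = t $ 1 \<and> v $ 3 * P (t $ 1) (v $ 1) (v $ 2) = t $ 2"
  by (auto simp: F_def vec_eq_iff forall_2)

text \<open>One formula in two roles, wherever \<open>P\<close> is nonzero: for fixed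
  \<open>t\<close> it parametrises the fibre over \<open>t\<close> by the plane, for fixed
  \<open>x\<close> and \<open>y\<close> it is a local section of \<open>F\<close>.\<close>

definition graph_point :: "real \<Rightarrow> real \<Rightarrow> real ^ 2 \<Rightarrow> real ^ 4" where
  "graph_point x y t = vector [x, y, t $ 2 / P (t $ 1) x y, t $ 1]"

lemma F_graph_point: "P (t $ 1) x y \<noteq> 0 \<Longrightarrow> F (graph_point x y t) = t"
  by (simp add: F_def graph_point_def vector_4 vec_eq_iff forall_2)

lemma fibre_eq_graph_point:
  assumes "v \<in> F -` {t}" "t $ 2 \<noteq> 0"
  shows "P (t $ 1) (v $ 1) (v $ 2) \<noteq> 0" "v = graph_point (v $ 1) (v $ 2) t"
  using assms unfolding mem_fibre_iff by (auto simp: graph_point_def vec_eq_iff forall_4 vector_4 eq_divide_eq)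

text \<open>Freezing the first two coordinates of \<open>v\<close> in \<open>graph_point\<close>
  gives a local section of \<open>F\<close> through \<open>v\<close>.\<close>

lemma submersion_at_F:
  assumes "F v $ 2 \<noteq> 0"
  shows "submersion_at F v"
proof -
  define t where "t = F v"
  define G where "G = graph_point (v $ 1) (v $ 2)"
  define q where "q s = P (s $ 1) (v $ 1) (v $ 2)" for s :: "real ^ 2"
  \<comment> \<open>The numerator of \<open>G\<close> over the common denominator \<open>q\<close>;
    the third coordinate of \<open>G\<close> already has this denominator.\<close>
  define p :: "real ^ 2 \<Rightarrow> real ^ 4" where
    "p s = vector [q s * v $ 1, q s * v $ 2, s $ 2, q s * s $ 1]" for s
  have v: "q t \<noteq> 0" "v = G t"
    using fibre_eq_graph_point[of v t] assms by (auto simp: t_def q_def G_def)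
  have q: "real_polynomial_function q"
    unfolding q_def by (intro rpf_intros)
  then have p: "polynomial_function p"
    unfolding polynomial_function_iff_vec_nth forall_4 p_def vector_4 by (intro conjI rpf_intros)
  have "continuous_on UNIV q"
    unfolding q_def by (intro continuous_intros)
  then have op: "open {s. q s \<noteq> 0}"
    by (simp add: open_Collect_neq)
  have "Ck_on_open (Suc 0) {s. q s \<noteq> 0} (\<lambda>s. p s /\<^sub>R q s)"
    using op p q by (rule Ck_on_open_rational) auto
  then have "Ck_on_open (Suc 0) {s. q s \<noteq> 0} G"
    by (rule Ck_on_open_cong[OF op, rotated])
      (auto simp: p_def G_def q_def graph_point_def vec_eq_iff forall_4 vector_4 field_simps)
  then have "G differentiable (at t)"
    using v(1) by simp
  with differentiable_at_polynomial_function[OF polynomial_function_F]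
  have "submersion_at F (G t)"
    by (rule submersion_at_local_section[OF _ _ op])
      (use v(1) in \<open>auto simp: G_def q_def F_graph_point\<close>)
  with v(2) show ?thesis by metis
qed

lemma ex_P_neq_0: "\<exists>x y. P s x y \<noteq> 0"
  using P_eq_0_iff[of s 0 1] by auto

lemma regular_values_F: "{t. t $ 2 \<noteq> 0} \<subseteq> range F - F ` Sing F"
proof
  fix t :: "real ^ 2" assume "t \<in> {t. t $ 2 \<noteq> 0}"
  then have "t \<notin> F ` Sing F"
    using submersion_at_F by (auto simp: Sing_def)
  moreover have "t \<in> range F"
    using F_graph_point ex_P_neq_0 by (metis rangeI)
  ultimately show "t \<in> range F - F ` Sing F" by blast
qed

section \<open>Diffeomorphisms between fibres, connectedness\<close>

text \<open>Translates the plane so that the puncture of the fibre over \<open>s\<close> moves to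
  that of the fibre over \<open>t\<close>, then lifts to the graph. The convention
  \<open>1 / 0 = 0\<close> covers a vanishing first coordinate as well. There the translation jumps
  with the parameter, so these maps do not assemble into a trivialisation.\<close>

definition shift :: "real ^ 2 \<Rightarrow> real ^ 2 \<Rightarrow> real ^ 4 \<Rightarrow> real ^ 4" where
  "shift s t v = graph_point (v $ 1 - 1 / s $ 1 + 1 / t $ 1) (v $ 2) t"

lemma P_shift_eq_0_iff: "P t (x - 1 / s + 1 / t) y = 0 \<longleftrightarrow> P s x y = 0"
  by (auto simp: P_eq_0_iff)

lemma shift_in_fibre:
  assumes "v \<in> F -` {s}" "s $ 2 \<noteq> 0"
  shows "shift s t v \<in> F -` {t}"
  using fibre_eq_graph_point(1)[OF assms] by (simp add: shift_def F_graph_point P_shift_eq_0_iff)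

lemma shift_shift:
  assumes "v \<in> F -` {s}" "s $ 2 \<noteq> 0"
  shows "shift t s (shift s t v) = v"
  using fibre_eq_graph_point(2)[OF assms] by (simp add: shift_def graph_point_def vector_4)

text \<open>The map is rational, and its denominator has no zeros on the fibre over \<open>s\<close>
  because the translation matches the punctures.\<close>

lemma smooth_on_shift:
  assumes "s $ 2 \<noteq> 0"
  shows "smooth_on (F -` {s}) (shift s t)"
proof -
  define a where "a v = v $ 1 - 1 / s $ 1 + 1 / t $ 1" for v :: "real ^ 4"
  define q where "q v = P (t $ 1) (a v) (v $ 2)" for v :: "real ^ 4"
  define p :: "real ^ 4 \<Rightarrow> real ^ 4" where
    "p v = vector [q v * a v, q v * v $ 2, t $ 2, q v * t $ 1]" for v
  have a: "real_polynomial_function a"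
    unfolding a_def by (intro rpf_intros)
  then have q: "real_polynomial_function q"
    unfolding q_def by (intro rpf_intros)
  with a have p: "polynomial_function p"
    unfolding polynomial_function_iff_vec_nth forall_4 p_def vector_4 by (intro conjI rpf_intros)
  have nz: "q v \<noteq> 0" if "v \<in> F -` {s}" for v
    using fibre_eq_graph_point(1)[OF that assms] by (simp add: q_def a_def P_shift_eq_0_iff)
  have "shift s t v = p v /\<^sub>R q v" if "v \<in> F -` {s}" for v
    using nz[OF that] unfolding shift_def graph_point_def a_def[symmetric] q_def[symmetric]
    by (simp add: p_def vec_eq_iff forall_4 vector_4 field_simps)
  with p q nz show ?thesis
    by (rule smooth_on_rational)
qed

lemma diffeomorphic_fibres:
  assumes "s $ 2 \<noteq> 0" "t $ 2 \<noteq> 0"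
  shows "diffeomorphic (F -` {s}) (F -` {t})"
proof -
  have "shift s t ` (F -` {s}) = F -` {t}" if "s $ 2 \<noteq> 0" "t $ 2 \<noteq> 0" for s t
  proof
    show "shift s t ` (F -` {s}) \<subseteq> F -` {t}"
      using shift_in_fibre that by blast
    show "F -` {t} \<subseteq> shift s t ` (F -` {s})"
      using shift_in_fibre shift_shift that by (metis image_eqI subsetI)
  qed
  with assms have "diffeomorphism (F -` {s}) (F -` {t}) (shift s t) (shift t s)"
    unfolding diffeomorphism_def using smooth_on_shift shift_shift by blast
  then show ?thesis
    unfolding diffeomorphic_def by blast
qed

text \<open>The graph parametrisation is continuous on the once punctured plane, which is connected,
  and maps it onto the fibre.\<close>

lemma connected_fibre:
  assumes "t $ 2 \<noteq> 0"
  shows "connected (F -` {t})"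
proof -
  define A where "A = - {vector [1 / t $ 1, 0] :: real ^ 2}"
  define g where "g w = graph_point (w $ 1) (w $ 2) t" for w :: "real ^ 2"
  have nz: "w \<in> A \<longleftrightarrow> P (t $ 1) (w $ 1) (w $ 2) \<noteq> 0" for w
    by (simp add: A_def P_eq_0_iff vec_eq_iff forall_2)
  have "connected A"
    unfolding A_def by (rule connected_punctured_universe) simp
  moreover have "continuous_on A g"
    unfolding g_def graph_point_def using nz by (intro continuous_on_vector_4 continuous_intros) auto
  ultimately have "connected (g ` A)"
    by (rule connected_continuous_image[rotated])
  moreover have "g ` A = F -` {t}"
  proof
    show "g ` A \<subseteq> F -` {t}"
      using nz by (auto simp: g_def F_graph_point)
    show "F -` {t} \<subseteq> g ` A"
    proof
      fix v assume "v \<in> F -` {t}"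
      from fibre_eq_graph_point[OF this assms] have "v = g (vector [v $ 1, v $ 2])"
        "vector [v $ 1, v $ 2] \<in> A"
        by (simp_all add: nz g_def)
      then show "v \<in> g ` A" by blast
    qed
  qed
  ultimately show ?thesis by simp
qed

section \<open>Failure of triviality over \<open>(0, 1)\<close>\<close>

text \<open>Dividing \<open>h\<close> by its norm would retract the disc onto its boundary circle.
  This is how the unit circle not being null-homotopic in the punctured plane enters.\<close>

lemma no_punctured_plane_extension:
  fixes h :: "real ^ 2 \<Rightarrow> real ^ 2"
  assumes "continuous_on (cball 0 1) h" "\<And>w. w \<in> cball 0 1 \<Longrightarrow> h w \<noteq> 0"
    and "\<And>w. norm w = 1 \<Longrightarrow> h w = w"
  shows False
proof -
  have "retraction (cball 0 1) (frontier (cball 0 1)) (\<lambda>w. h w /\<^sub>R norm (h w))"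
    unfolding retraction_def using assms
    by (auto intro!: continuous_intros simp: frontier_cball)
  then show False
    using no_retraction_cball[of 1 "0 :: real ^ 2"] unfolding retract_of_def by auto
qed

lemma not_smoothly_trivial_F: "\<not> smoothly_trivial_at F (vector [0, 1])"
proof
  let ?t0 = "vector [0, 1] :: real ^ 2"
  assume "smoothly_trivial_at F ?t0"
  then obtain D \<Phi> \<Psi> where D: "open D" "?t0 \<in> D"
    and diff: "diffeomorphism (F -` D) ((F -` {?t0}) \<times> D) \<Phi> \<Psi>"
    and snd: "\<And>x. x \<in> F -` D \<Longrightarrow> snd (\<Phi> x) = F x"
    unfolding smoothly_trivial_at_def by blast
  obtain e where e: "e > 0" "ball ?t0 e \<subseteq> D"
    using D open_contains_ball by blast
  \<comment> \<open>Being below \<open>e\<close> keeps the base points of the cap in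
    \<open>D\<close>; being at most \<open>1\<close> keeps the puncture
    \<open>1 / \<sigma> w\<close> away from the point \<open>w\<close> of the disc.\<close>
  define \<epsilon> where "\<epsilon> = min (e / 2) 1"
  have \<epsilon>: "0 < \<epsilon>" "\<epsilon> < e" "\<epsilon> \<le> 1"
    using e by (auto simp: \<epsilon>_def)
  \<comment> \<open>The parameter is \<open>\<epsilon>\<close> at the centre of the disc and
    \<open>0\<close> on the unit circle, so the cap is bounded by the circle in the fibre over
    \<open>?t0\<close>.\<close>
  define \<sigma> where "\<sigma> w = \<epsilon> * (1 - norm w)" for w :: "real ^ 2"
  define cap where "cap w = graph_point (w $ 1) (w $ 2) (vector [\<sigma> w, 1])" for w
  define \<pi> :: "real ^ 4 \<Rightarrow> real ^ 2" where "\<pi> v = v $ 1 *\<^sub>R axis 1 1 + v $ 2 *\<^sub>R axis 2 1" for v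
  \<comment> \<open>Pushes the cap into the fibre over \<open>?t0\<close> by keeping the fibre
    component of \<open>\<Phi>\<close> and resetting the base component, then projects to the
    plane.\<close>
  define h where "h w = \<pi> (\<Psi> (fst (\<Phi> (cap w)), ?t0))" for w
  have nz: "P (\<sigma> w) (w $ 1) (w $ 2) \<noteq> 0" if "w \<in> cball 0 1" for w
  proof
    assume "P (\<sigma> w) (w $ 1) (w $ 2) = 0"
    then have w: "w $ 1 = 1 / \<sigma> w" "w $ 2 = 0"
      by (auto simp: P_eq_0_iff)
    then have n: "norm w = \<bar>1 / \<sigma> w\<bar>"
      by (simp add: norm_vec_def L2_set_def sum_2)
    show False
    \<comment> \<open>At the centre \<open>1 / \<epsilon>\<close> is nonzero. On the circle
      \<open>\<sigma> w = 0\<close>, so \<open>1 / \<sigma> w\<close> is \<open>0\<close> instead of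
      having absolute value \<open>1\<close>. In between, \<open>\<sigma> w < 1\<close> puts the
      puncture outside the unit disc.\<close>
    proof (cases "norm w = 0 \<or> norm w = 1")
      case True
      then have "\<sigma> w = (if norm w = 0 then \<epsilon> else 0)" by (auto simp: \<sigma>_def)
      then show False using True n \<epsilon> by (auto split: if_splits)
    next
      case False
      then have "0 < norm w" "norm w < 1" using that by auto
      moreover from this have "\<sigma> w \<le> 1 - norm w"
        unfolding \<sigma>_def using \<epsilon> by (intro mult_left_le_one_le) auto
      ultimately have "\<sigma> w < 1" by linarith
      moreover have "0 < \<sigma> w"
        using \<epsilon> \<open>norm w < 1\<close> by (simp add: \<sigma>_def)
      ultimately have "1 < 1 / \<sigma> w" by simp
      then show False using n \<open>norm w < 1\<close> by linarith
    qed
  qed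
  have FD: "vector [\<sigma> w, 1] \<in> D" if "w \<in> cball 0 1" for w
  proof -
    have "0 \<le> \<sigma> w" "\<sigma> w \<le> \<epsilon>"
      using that \<epsilon> by (auto simp: \<sigma>_def intro!: mult_left_le)
    then have "\<bar>\<sigma> w\<bar> < e"
      using \<epsilon> by linarith
    then have "dist ?t0 (vector [\<sigma> w, 1]) < e"
      by (simp add: dist_vec_def L2_set_def sum_2 dist_real_def)
    with e show ?thesis by auto
  qed
  have cap: "F (cap w) = vector [\<sigma> w, 1]" if "w \<in> cball 0 1" for w
    using nz[OF that] by (simp add: cap_def F_graph_point)
  then have capD: "cap ` cball 0 1 \<subseteq> F -` D"
    using FD by auto
  from diff have \<Phi>: "\<Phi> ` (F -` D) = (F -` {?t0}) \<times> D" "smooth_on (F -` D) \<Phi>"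
      "\<forall>x\<in>F -` D. \<Psi> (\<Phi> x) = x"
    and \<Psi>: "\<Psi> ` ((F -` {?t0}) \<times> D) = F -` D" "smooth_on ((F -` {?t0}) \<times> D) \<Psi>"
      "\<forall>y\<in>(F -` {?t0}) \<times> D. \<Phi> (\<Psi> y) = y"
    unfolding diffeomorphism_def by - (elim conjE, assumption)+
  note cont = smooth_on_imp_continuous_on[OF \<Phi>(2)] smooth_on_imp_continuous_on[OF \<Psi>(2)]
  have fst: "(fst (\<Phi> (cap w)), ?t0) \<in> (F -` {?t0}) \<times> D" if "w \<in> cball 0 1" for w
  proof -
    have "\<Phi> (cap w) \<in> (F -` {?t0}) \<times> D"
      using capD \<Phi>(1) that by blast
    with D show ?thesis by (auto simp: mem_Times_iff)
  qed
  show False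
  proof (rule no_punctured_plane_extension)
    have "continuous_on (cball 0 1) cap"
      unfolding cap_def graph_point_def using nz
      by (intro continuous_on_vector_4) (auto intro!: continuous_intros simp: \<sigma>_def)
    then have "continuous_on (cball 0 1) (\<lambda>w. \<Phi> (cap w))"
      by (rule continuous_on_compose2[OF cont(1)]) (use capD in auto)
    then have "continuous_on (cball 0 1) (\<lambda>w. \<Psi> (fst (\<Phi> (cap w)), ?t0))"
      by (intro continuous_on_compose2[OF cont(2)] continuous_intros) (use fst in auto)
    then show "continuous_on (cball 0 1) h"
      unfolding h_def \<pi>_def by (intro continuous_intros)
  next
    \<comment> \<open>The pushed point lies in the fibre over \<open>?t0\<close>, whose points
      project to the plane without the zero of \<open>P 0\<close>, the origin.\<close>
    fix w :: "real ^ 2" assume "w \<in> cball 0 1"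
    define v where "v = \<Psi> (fst (\<Phi> (cap w)), ?t0)"
    have y: "(fst (\<Phi> (cap w)), ?t0) \<in> (F -` {?t0}) \<times> D"
      using fst \<open>w \<in> cball 0 1\<close> by blast
    then have "v \<in> F -` D"
      using \<Psi>(1) unfolding v_def by blast
    then have "F v = ?t0"
      using snd bspec[OF \<Psi>(3) y] unfolding v_def by force
    then have "P 0 (v $ 1) (v $ 2) \<noteq> 0"
      using fibre_eq_graph_point(1)[of v ?t0] by simp
    then show "h w \<noteq> 0"
      unfolding h_def v_def[symmetric] by (simp add: P_eq_0_iff \<pi>_def vec_eq_iff forall_2 axis_def)
  next
    \<comment> \<open>Over the circle the cap already lies in the fibre over \<open>?t0\<close>, so
      resetting the base component changes nothing.\<close>
    fix w :: "real ^ 2" assume w: "norm w = 1"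
    then have F: "F (cap w) = ?t0"
      using cap by (simp add: \<sigma>_def)
    then have "cap w \<in> F -` D"
      using D by simp
    then have "\<Phi> (cap w) = (fst (\<Phi> (cap w)), ?t0)"
      using snd F by (metis prod.collapse)
    then have "\<Psi> (fst (\<Phi> (cap w)), ?t0) = cap w"
      using \<Phi>(3) \<open>cap w \<in> F -` D\<close> by metis
    then show "h w = w"
      by (simp add: h_def \<pi>_def cap_def graph_point_def vec_eq_iff forall_2 vector_4 axis_def)
  qed
qed

theorem theorem2p1:
  shows "\<exists>(F :: real ^ 4 \<Rightarrow> real ^ 2) (t0 :: real ^ 2).
    polynomial_function F \<and>
    t0 \<in> interior (range F - F ` Sing F) \<and>
    (\<exists>N. open N \<and> t0 \<in> N \<and>
       (\<forall>t\<in>N. connected (F -` {t})) \<and>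
       (\<forall>s\<in>N. \<forall>t\<in>N. diffeomorphic (F -` {s}) (F -` {t}))) \<and>
    t0 \<in> bifurcation_values F"
proof (intro exI conjI)
  \<comment> \<open>The single open set \<open>?N\<close> serves both as a set of regular values in
    the image and as the neighbourhood with good fibres.\<close>
  let ?t0 = "vector [0, 1] :: real ^ 2" and ?N = "{t :: real ^ 2. t $ 2 \<noteq> 0}"
  show op: "open ?N"
    by (intro open_Collect_neq continuous_intros)
  show t0: "?t0 \<in> ?N" by simp
  show "polynomial_function F"
    by (rule polynomial_function_F)
  show "?t0 \<in> interior (range F - F ` Sing F)"
    using op t0 regular_values_F by (meson interiorI)
  show "\<forall>t\<in>?N. connected (F -` {t})"
    using connected_fibre by blast
  show "\<forall>s\<in>?N. \<forall>t\<in>?N. diffeomorphic (F -` {s}) (F -` {t})"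
    using diffeomorphic_fibres by blast
  show "?t0 \<in> bifurcation_values F"
    using not_smoothly_trivial_F by (simp add: bifurcation_values_def)
qed

end
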